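(* The ideal $\mathcal{K}$ is an $F_\sigma$, tall, $K$-uniform ideal on $K$ which is not Katětov equivalent to $\mathcal{ED}_{fin}$.
   Context: A graph on $\omega$ is identified with its edge set, a subset of $[\omega]^2$. For each $n\in\omega$ fix a complete graph $K_n\subseteq[\omega]^2$ on $n$ vertices such that $K_n\cap K_m=\emptyset$ for $n\neq m$, and let $K=\bigcup_{n\in\omega}K_n$. $\mathcal{K}$ is the ideal on $K$ defined by: $X\in\mathcal{K}$ iff there is $n\in\omega$ such that $X$ does not contain a copy of $K_n$ (i.e. there are no $n$ vertices all of whose pairs belong to $X$). For ideals $\mathcal{I}$ on $X$ and $\mathcal{J}$ on $Y$, $\mathcal{I}\le_K\mathcal{J}$ means there is $f:Y\to X$ with $f^{-1}[A]\in\mathcal{J}$ for all $A\in\mathcal{I}$; Katětov equivalent means $\le_K$ in both directions. An ideal $\mathcal{I}$ is $K$-uniform if $\mathcal{I}\restriction X\le_K\mathcal{I}$ for every $X\in\mathcal{I}^+$, where $\mathcal{I}\restriction X=\{A\cap X: A\in\mathcal{I}\}$. An ideal on a countable set is tall if every infinite subset has infinite intersection with some member of the ideal. $\mathcal{ED}$ is the ideal on $\omega\times\omega$ generated by the columns $\{n\}\times\omega$ and the graphs of functions $\omega\to\omega$, and $\mathcal{ED}_{fin}$ is its restriction to $\Delta=\{(n,m): m\le n\}$.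
   Formalization: The complete graphs K_n are assumed to be pairwise disjoint as graphs (no common vertex), not merely to have disjoint edge sets; with only disjoint edge sets K may contain an infinite complete graph and K-uniformity can fail. *)

theory Defs
  imports "HOL-Analysis.Analysis" "HOL-Library.Ramsey" "HOL-Library.Disjoint_Sets"
begin

(* The ground set of an ideal is always an explicit parameter.  Ideals are proper and
   contain the finite subsets of their ground set. *)
definition ideal_on :: "'a set \<Rightarrow> 'a set set \<Rightarrow> bool" where
  "ideal_on S \<I> \<longleftrightarrow>
     \<I> \<subseteq> Pow S \<and> S \<notin> \<I> \<and> (\<forall>F. F \<subseteq> S \<and> finite F \<longrightarrow> F \<in> \<I>) \<and>
     (\<forall>A\<in>\<I>. \<forall>B. B \<subseteq> A \<longrightarrow> B \<in> \<I>) \<and> (\<forall>A\<in>\<I>. \<forall>B\<in>\<I>. A \<union> B \<in> \<I>)"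

definition restrict_ideal :: "'a set set \<Rightarrow> 'a set \<Rightarrow> 'a set set" where
  "restrict_ideal \<I> X = {A \<inter> X | A. A \<in> \<I>}"

(* The ideal generated by a family: the subsets of S covered by finitely many generators. *)
definition generated_ideal :: "'a set \<Rightarrow> 'a set set \<Rightarrow> 'a set set" where
  "generated_ideal S \<G> = {A. A \<subseteq> S \<and> (\<exists>\<F>. finite \<F> \<and> \<F> \<subseteq> \<G> \<and> A \<subseteq> \<Union>\<F>)}"

definition katetov_le :: "'a set \<Rightarrow> 'a set set \<Rightarrow> 'b set \<Rightarrow> 'b set set \<Rightarrow> bool" where
  "katetov_le X \<I> Y \<J> \<longleftrightarrow> (\<exists>f \<in> Y \<rightarrow> X. \<forall>A\<in>\<I>. f -` A \<inter> Y \<in> \<J>)"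

definition katetov_equivalent :: "'a set \<Rightarrow> 'a set set \<Rightarrow> 'b set \<Rightarrow> 'b set set \<Rightarrow> bool" where
  "katetov_equivalent X \<I> Y \<J> \<longleftrightarrow> katetov_le X \<I> Y \<J> \<and> katetov_le Y \<J> X \<I>"

definition K_uniform :: "'a set \<Rightarrow> 'a set set \<Rightarrow> bool" where
  "K_uniform S \<I> \<longleftrightarrow> (\<forall>X. X \<subseteq> S \<and> X \<notin> \<I> \<longrightarrow> katetov_le X (restrict_ideal \<I> X) S \<I>)"

definition tall_ideal :: "'a set \<Rightarrow> 'a set set \<Rightarrow> bool" where
  "tall_ideal S \<I> \<longleftrightarrow> (\<forall>Y. Y \<subseteq> S \<and> infinite Y \<longrightarrow> (\<exists>A\<in>\<I>. infinite (Y \<inter> A)))"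

(* Pow S is identified, via characteristic functions, with the product space 2^S. *)
definition F_sigma_ideal :: "'a set \<Rightarrow> 'a set set \<Rightarrow> bool" where
  "F_sigma_ideal S \<I> \<longleftrightarrow>
     fsigma_in (product_topology (\<lambda>_. discrete_topology (UNIV :: bool set)) S)
       ((\<lambda>A. \<lambda>x\<in>S. x \<in> A) ` \<I>)"

definition ED :: "(nat \<times> nat) set set" where
  "ED = generated_ideal UNIV
     ({{n} \<times> UNIV | n. True} \<union> {{(n, h n) | n. True} | h. True})"

definition Delta :: "(nat \<times> nat) set" where
  "Delta = {(n, m). m \<le> n}"

definition ED_fin :: "(nat \<times> nat) set set" where
  "ED_fin = restrict_ideal ED Delta"

(* A graph on the natural numbers is its set of edges (two-element sets). *)
definition complete_graph :: "nat \<Rightarrow> nat set set \<Rightarrow> bool" where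
  "complete_graph n E \<longleftrightarrow> (\<exists>W. finite W \<and> card W = n \<and> E = nsets W 2)"

(* The cliques C range over all n-element vertex sets of natural numbers,
   not only over subgraphs of the components from which K was built. *)
definition clique_ideal :: "nat set set \<Rightarrow> nat set set set" where
  "clique_ideal K = {X. X \<subseteq> K \<and> (\<exists>n. \<not> (\<exists>C. complete_graph n C \<and> C \<subseteq> X))}"

(* K n are pairwise disjoint complete graphs, one for each size.  Disjointness is that of
   graphs, i.e. no common vertex; \<Union>(K n) is the set of vertices on edges of K n.
   Disjoint edge sets alone would not do: the union of edge-disjoint K n may contain an
   infinite complete graph, and the clique ideal may then fail to be K-uniform. *)
definition disjoint_complete_graphs :: "(nat \<Rightarrow> nat set set) \<Rightarrow> bool" where
  "disjoint_complete_graphs K \<longleftrightarrow>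
     (\<forall>n. complete_graph n (K n)) \<and> disjoint_family (\<lambda>n. \<Union>(K n))"

end

theory Submission
  imports Defs
begin

text \<open>Distinct components share no vertex, so every clique on at least two vertices lies in a
  single component; with Ramsey's theorem for closure under unions, this gives all the positive
  claims. For the negative one, members of \<open>ED_fin\<close> have columns of bounded size. Given
  \<open>f\<close> from \<open>Delta\<close> to \<open>E\<close>, either some finite set of components already has a preimage with
  unbounded columns, or one can choose columns mapping mostly into later and later components
  and, for each, a bipartite set of edges whose preimage contains half of what remains. The union of
  these edge sets is triangle-free, yet its preimage has unbounded columns.\<close>

section \<open>Cliques in edge sets; closure of the ideal under unions\<close>

definition has_clique :: "nat set set \<Rightarrow> nat \<Rightarrow> bool" where
  "has_clique X n \<longleftrightarrow> (\<exists>W. finite W \<and> card W = n \<and> nsets W 2 \<subseteq> X)"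

lemma clique_ideal_iff: "A \<in> clique_ideal S \<longleftrightarrow> A \<subseteq> S \<and> (\<exists>n. \<not> has_clique A n)"
  unfolding clique_ideal_def complete_graph_def has_clique_def by blast

lemma has_clique_mono: "has_clique A n \<Longrightarrow> A \<subseteq> B \<Longrightarrow> has_clique B n"
  unfolding has_clique_def by blast

lemma has_clique_le:
  assumes "has_clique A n" "m \<le> n"
  shows "has_clique A m"
proof -
  obtain W where W: "finite W" "card W = n" "nsets W 2 \<subseteq> A"
    using assms(1) unfolding has_clique_def by blast
  obtain V where "V \<subseteq> W" "card V = m" "finite V"
    using obtain_subset_with_card_n[of m W] assms(2) W by metis
  then show ?thesis
    unfolding has_clique_def using W nsets_mono by blast
qed

lemma nsets_2_subset_iff:
  "nsets W 2 \<subseteq> A \<longleftrightarrow> (\<forall>x\<in>W. \<forall>y\<in>W. x \<noteq> y \<longrightarrow> {x, y} \<in> A)"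
  by (auto simp: nsets_2_eq)

text \<open>A single vertex of a clique on \<open>card A + 3\<close> vertices already lies on
  \<open>card A + 2\<close> distinct edges.\<close>

lemma finite_not_has_clique:
  assumes "finite A"
  shows "\<not> has_clique A (card A + 3)"
proof
  assume "has_clique A (card A + 3)"
  then obtain W where W: "finite W" "card W = card A + 3" "nsets W 2 \<subseteq> A"
    unfolding has_clique_def by blast
  obtain w where "w \<in> W"
    using W(2) by fastforce
  have "inj_on (\<lambda>x. {w, x}) (W - {w})"
    by (auto simp: inj_on_def doubleton_eq_iff)
  moreover have "(\<lambda>x. {w, x}) ` (W - {w}) \<subseteq> A"
    using W(3) \<open>w \<in> W\<close> by (auto simp: nsets_2_subset_iff)
  ultimately have "card (W - {w}) \<le> card A"
    using assms by (metis card_inj_on_le)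
  then show False
    using W \<open>w \<in> W\<close> by simp
qed

text \<open>Ramsey's theorem: when pairs are coloured by membership in \<open>A\<close>, a
  homogeneous set is an \<open>m\<close>-clique of \<open>A\<close> or an \<open>n\<close>-set whose
  pairs avoid \<open>A\<close> and hence lie in \<open>B\<close>.\<close>

lemma not_has_clique_Un:
  assumes "\<not> has_clique A m" "\<not> has_clique B n"
  shows "\<exists>r. \<not> has_clique (A \<union> B) r"
proof -
  obtain r where r: "\<And>V E. finite (V :: nat set) \<Longrightarrow> card V \<ge> r \<Longrightarrow>
      \<exists>R\<subseteq>V. card R = m \<and> clique R E \<or> card R = n \<and> indep R E"
    using ramsey2[of m n] by blast
  have "\<not> has_clique (A \<union> B) (r + m + n + 1)"
  proof
    assume "has_clique (A \<union> B) (r + m + n + 1)"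
    then obtain W where W: "finite W" "card W = r + m + n + 1" "nsets W 2 \<subseteq> A \<union> B"
      unfolding has_clique_def by blast
    obtain R where R: "R \<subseteq> W" "card R = m \<and> clique R A \<or> card R = n \<and> indep R A"
      using r[of W A] W by auto
    have "finite R"
      using R W finite_subset by blast
    from R(2) show False
    proof
      assume "card R = m \<and> clique R A"
      then have "has_clique A m"
        unfolding has_clique_def using \<open>finite R\<close>
        by (auto simp: clique_def nsets_2_subset_iff intro!: exI[of _ R])
      then show False
        using assms by blast
    next
      assume "card R = n \<and> indep R A"
      moreover have "{x, y} \<in> A \<union> B" if "x \<in> R" "y \<in> R" "x \<noteq> y" for x y
        using that R(1) W(3) unfolding nsets_2_subset_iff by blast
      ultimately have "nsets R 2 \<subseteq> B" "card R = n"
        unfolding nsets_2_subset_iff indep_def by blast+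
      then have "has_clique B n"
        unfolding has_clique_def using \<open>finite R\<close> by blast
      then show False
        using assms by blast
    qed
  qed
  then show ?thesis
    by blast
qed

lemma clique_ideal_subset:
  assumes "A \<in> clique_ideal S" "B \<subseteq> A"
  shows "B \<in> clique_ideal S"
proof -
  obtain n where "A \<subseteq> S" "\<not> has_clique A n"
    using assms(1) by (auto simp: clique_ideal_iff)
  moreover from this have "\<not> has_clique B n"
    using has_clique_mono assms(2) by blast
  ultimately show ?thesis
    using assms(2) by (auto simp: clique_ideal_iff)
qed

lemma clique_ideal_Un:
  assumes "A \<in> clique_ideal S" "B \<in> clique_ideal S"
  shows "A \<union> B \<in> clique_ideal S"
proof -
  obtain m n where "\<not> has_clique A m" "\<not> has_clique B n"
    using assms by (auto simp: clique_ideal_iff)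
  then obtain r where "\<not> has_clique (A \<union> B) r"
    using not_has_clique_Un by blast
  then show ?thesis
    using assms by (auto simp: clique_ideal_iff)
qed

section \<open>Descriptive complexity of the ideal\<close>

text \<open>The ideal is the union over \<open>n\<close> of the families of graphs without an
  \<open>n\<close>-clique. Each is closed: completeness on a fixed finite vertex set concerns
  finitely many coordinates, so the complement is a union of open boxes.\<close>

lemma F_sigma_clique_ideal: "F_sigma_ideal S (clique_ideal S)"
proof -
  let ?T = "product_topology (\<lambda>_. discrete_topology (UNIV :: bool set)) S"
  let ?char = "\<lambda>A. \<lambda>x\<in>S. x \<in> A"
  define C where "C n = ?char ` {A. A \<subseteq> S \<and> \<not> has_clique A n}" for n
  \<comment> \<open>\<open>V W\<close> collects the characteristic functions of graphs complete on
    \<open>W\<close>. The conjunct \<open>e \<in> S\<close> makes it empty when a pair falls outside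
    \<open>S\<close>, where the value of \<open>g\<close> is a mere default.\<close>
  define V where "V W = {g \<in> S \<rightarrow>\<^sub>E (UNIV :: bool set). \<forall>e\<in>nsets W 2. e \<in> S \<and> g e}" for W :: "nat set"
  have openV: "openin ?T (V W)" if "finite W" for W
  proof (cases "nsets W 2 \<subseteq> S")
    case True
    have "V W = Pi\<^sub>E S (\<lambda>e. if e \<in> nsets W 2 then {True} else UNIV)"
    proof -
      have "(b \<in> (if c then {True} else UNIV)) \<longleftrightarrow> (c \<longrightarrow> b)" for b c
        by auto
      then show ?thesis
        using True by (auto simp: V_def PiE_iff extensional_def)
    qed
    moreover have "finite {e \<in> S. (if e \<in> nsets W 2 then {True} else UNIV) \<noteq> UNIV}"
      by (rule finite_subset[of _ "nsets W 2"]) (auto simp: that finite_imp_finite_nsets)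
    ultimately show ?thesis
      by (simp add: openin_PiE_gen)
  next
    case False
    then have "V W = {}"
      by (auto simp: V_def)
    then show ?thesis
      by simp
  qed
  have "closedin ?T (C n)" for n
  proof -
    have "C n = topspace ?T - (\<Union>W\<in>{W. finite W \<and> card W = n}. V W)"
    proof (intro equalityI subsetI)
      fix g assume "g \<in> C n"
      then show "g \<in> topspace ?T - (\<Union>W\<in>{W. finite W \<and> card W = n}. V W)"
        by (auto simp: C_def V_def has_clique_def subset_iff) metis
    next
      fix g assume g: "g \<in> topspace ?T - (\<Union>W\<in>{W. finite W \<and> card W = n}. V W)"
      let ?A = "{e \<in> S. g e}"
      have "g = ?char ?A"
        using g by (auto simp: fun_eq_iff PiE_iff extensional_def)
      moreover have "\<not> has_clique ?A n"
        using g by (fastforce simp: V_def has_clique_def)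
      ultimately show "g \<in> C n"
        by (auto simp: C_def intro!: image_eqI[of _ _ ?A])
    qed
    moreover have "openin ?T (\<Union>W\<in>{W. finite W \<and> card W = n}. V W)"
      by (rule openin_Union) (use openV in auto)
    ultimately show ?thesis
      by (simp only: closedin_diff closedin_topspace)
  qed
  then have "fsigma_in ?T (\<Union>(range C))"
    by (intro fsigma_in_Union) (auto intro: closed_imp_fsigma_in)
  moreover have "\<Union>(range C) = ?char ` clique_ideal S"
  proof -
    have eq: "clique_ideal S = (\<Union>n. {A. A \<subseteq> S \<and> \<not> has_clique A n})"
      by (auto simp: clique_ideal_iff)
    show ?thesis
      unfolding C_def eq image_UN by (rule refl)
  qed
  ultimately show ?thesis
    unfolding F_sigma_ideal_def by simp
qed

section \<open>Edge cuts\<close>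

text \<open>Adding one vertex at a time, the new vertex is put on the side of the cut
  that separates at least half of its edges to the earlier vertices.\<close>
lemma half_cut:
  fixes f :: "'b \<Rightarrow> 'a set"
  assumes "finite V" "finite D" "\<forall>d\<in>D. f d \<in> nsets V 2"
  shows "\<exists>S. card D \<le> 2 * card {d \<in> D. card (f d \<inter> S) = 1}"
  using assms
proof (induction V arbitrary: D rule: finite_induct)
  case empty
  then have "D = {}"
    by (auto simp: nsets_2_eq)
  then show ?case
    by simp
next
  case (insert v V)
  let ?D' = "{d \<in> D. v \<notin> f d}" and ?Dv = "{d \<in> D. v \<in> f d}"
  have "\<forall>d\<in>?D'. f d \<in> nsets V 2"
    using insert.prems(2) by (fastforce simp: nsets_def)
  then obtain S0 where S0: "card ?D' \<le> 2 * card {d \<in> ?D'. card (f d \<inter> S0) = 1}"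
    using insert.IH[of ?D'] insert.prems(1) by auto
  \<comment> \<open>The two possible sides for \<open>v\<close>. The arbitrary set \<open>S0\<close>
    may already contain \<open>v\<close>, so one choice removes it explicitly.\<close>
  define S where "S b = (if b then insert v S0 else S0 - {v})" for b
  let ?cut = "\<lambda>b. {d \<in> ?Dv. card (f d \<inter> S b) = 1}"
  \<comment> \<open>An edge \<open>{v, w}\<close> crosses exactly one of the two cuts, depending on
    whether \<open>w \<in> S0\<close>; so one cut is crossed by at least half of the edges at
    \<open>v\<close>.\<close>
  have "?Dv \<subseteq> ?cut True \<union> ?cut False"
  proof
    fix d assume d: "d \<in> ?Dv"
    then obtain x y where "f d = {x, y}" "x \<noteq> y"
      using insert.prems(2) by (metis (no_types, lifting) mem_Collect_eq nsets2_E)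
    then obtain w where w: "f d = {v, w}" "w \<noteq> v"
      using d by (cases "v = x") (auto simp: insert_commute)
    show "d \<in> ?cut True \<union> ?cut False"
      using d w by (cases "w \<in> S0") (auto simp: S_def)
  qed
  then have "card ?Dv \<le> card (?cut True \<union> ?cut False)"
    by (intro card_mono) (use insert.prems(1) in auto)
  also have "\<dots> \<le> card (?cut True) + card (?cut False)"
    by (rule card_Un_le)
  finally have "card ?Dv \<le> 2 * card (?cut True) \<or> card ?Dv \<le> 2 * card (?cut False)"
    by linarith
  then obtain b where b: "card ?Dv \<le> 2 * card (?cut b)"
    by blast
  have same: "f d \<inter> S b = f d \<inter> S0" if "v \<notin> f d" for d
    using that by (auto simp: S_def)
  have "{d \<in> D. card (f d \<inter> S b) = 1} = {d \<in> ?D'. card (f d \<inter> S0) = 1} \<union> ?cut b"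
    using same by auto
  moreover have "card ({d \<in> ?D'. card (f d \<inter> S0) = 1} \<union> ?cut b) =
      card {d \<in> ?D'. card (f d \<inter> S0) = 1} + card (?cut b)"
    by (intro card_Un_disjoint) (use insert.prems(1) in auto)
  moreover have "card D = card ?D' + card ?Dv"
  proof -
    have "card (?D' \<union> ?Dv) = card ?D' + card ?Dv"
      by (intro card_Un_disjoint) (use insert.prems(1) in auto)
    moreover have "?D' \<union> ?Dv = D"
      by auto
    ultimately show ?thesis
      by simp
  qed
  ultimately show ?case
    using S0 b by (intro exI[of _ "S b"]) simp
qed

text \<open>Two of the three vertices of a triangle are on the same side of \<open>S\<close>, and
  the edge between them meets \<open>S\<close> in 0 or 2 points.\<close>

lemma cut_triangle_free:
  assumes "\<forall>e\<in>A. card (e \<inter> S) = 1"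
  shows "\<not> has_clique A 3"
proof
  assume "has_clique A 3"
  then obtain x y z where "x \<noteq> y" "x \<noteq> z" "y \<noteq> z" "{x, y} \<in> A" "{x, z} \<in> A" "{y, z} \<in> A"
    unfolding has_clique_def card_3_iff nsets_2_subset_iff by auto
  then show False
    using assms by (cases "x \<in> S"; cases "y \<in> S"; cases "z \<in> S") force+
qed

section \<open>Column sizes in \<open>ED_fin\<close>\<close>

text \<open>Each generator has bounded columns below the diagonal, and bounds add up over finite
  unions. The negative claim rests on this property.\<close>

lemma ED_fin_columns_bounded:
  assumes "X \<in> ED_fin"
  shows "\<exists>k. \<forall>n. card {m. m \<le> n \<and> (n, m) \<in> X} \<le> k"
proof -
  define \<G> where "\<G> = {{n} \<times> UNIV | n. True} \<union> {{(n, h n) | n. True} | h :: nat \<Rightarrow> nat. True}"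
  obtain A where A: "A \<in> ED" "X \<subseteq> A"
    using assms unfolding ED_fin_def restrict_ideal_def by blast
  have "\<exists>F. finite F \<and> F \<subseteq> \<G> \<and> A \<subseteq> \<Union>F"
    using A(1) unfolding ED_def generated_ideal_def mem_Collect_eq \<G>_def by (rule conjunct2)
  then obtain F where F: "finite F" "F \<subseteq> \<G>" "X \<subseteq> \<Union>F"
    using A(2) by blast
  have gen: "\<exists>k. \<forall>n. card {m. m \<le> n \<and> (n, m) \<in> G} \<le> k" if "G \<in> \<G>" for G
    using that unfolding \<G>_def
  proof
    assume "G \<in> {{n} \<times> UNIV | n. True}"
    then obtain c where c: "G = {c} \<times> UNIV"
      by auto
    \<comment> \<open>Column \<open>c\<close> of \<open>Delta\<close> consists of the
      \<open>c + 1\<close> points with second coordinate at most \<open>c\<close>; the other columns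
      miss this generator.\<close>
    have "card {m. m \<le> n \<and> (n, m) \<in> G} \<le> c + 1" for n
    proof (cases "n = c")
      case True
      then have "{m. m \<le> n \<and> (n, m) \<in> G} = {..c}"
        by (auto simp: c)
      then show ?thesis
        by simp
    qed (simp add: c)
    then show ?thesis
      by blast
  next
    assume "G \<in> {{(n, h n) | n. True} | h :: nat \<Rightarrow> nat. True}"
    then obtain h :: "nat \<Rightarrow> nat" where h: "G = {(n, h n) | n. True}"
      by auto
    have "card {m. m \<le> n \<and> (n, m) \<in> G} \<le> card {h n}" for n
      by (rule card_mono) (auto simp: h)
    then show ?thesis
      by (metis card_1_singleton_iff One_nat_def)
  qed
  from F(1,2) have "\<exists>k. \<forall>n. card {m. m \<le> n \<and> (n, m) \<in> \<Union>F} \<le> k"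
  proof (induction F rule: finite_induct)
    case (insert G F)
    then obtain k l where kl: "\<And>n. card {m. m \<le> n \<and> (n, m) \<in> \<Union>F} \<le> k"
        "\<And>n. card {m. m \<le> n \<and> (n, m) \<in> G} \<le> l"
      using gen[of G] by (meson insert_subset)
    have "card {m. m \<le> n \<and> (n, m) \<in> \<Union>(insert G F)} \<le> k + l" for n
    proof -
      have eq: "{m. m \<le> n \<and> (n, m) \<in> \<Union>(insert G F)} =
          {m. m \<le> n \<and> (n, m) \<in> \<Union>F} \<union> {m. m \<le> n \<and> (n, m) \<in> G}"
        by auto
      show ?thesis
        unfolding eq by (intro order_trans[OF card_Un_le] add_mono kl)
    qed
    then show ?case
      by blast
  qed simp
  then obtain k where k: "\<And>n. card {m. m \<le> n \<and> (n, m) \<in> \<Union>F} \<le> k"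
    by blast
  have "card {m. m \<le> n \<and> (n, m) \<in> X} \<le> card {m. m \<le> n \<and> (n, m) \<in> \<Union>F}" for n
    by (rule card_mono) (use F(3) in auto)
  then show ?thesis
    using k le_trans by blast
qed

section \<open>Vertex-disjoint components\<close>

locale clique_sequence =
  fixes K :: "nat \<Rightarrow> nat set set"
  assumes disjoint: "disjoint_complete_graphs K"
begin

abbreviation "E \<equiv> \<Union>n. K n"

lemma vertex_set: "\<exists>W. finite W \<and> card W = n \<and> K n = nsets W 2"
  using disjoint unfolding disjoint_complete_graphs_def complete_graph_def by blast

lemma finite_K: "finite (K n)"
  using vertex_set[of n] finite_imp_finite_nsets by auto

lemma finite_K_le: "finite (\<Union>i\<le>m. K i)"
  by (simp add: finite_K)

lemma K_edge: "e \<in> K n \<Longrightarrow> \<exists>x y. x \<noteq> y \<and> e = {x, y}"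
  using vertex_set[of n] by (metis nsets2_E)

text \<open>Vertex-disjointness enters here: a common vertex, not only a common edge, determines the
  component.\<close>

lemma K_unique:
  assumes "e \<in> K n" "e' \<in> K m" "v \<in> e" "v \<in> e'"
  shows "n = m"
proof (rule ccontr)
  assume "n \<noteq> m"
  then have "\<Union>(K n) \<inter> \<Union>(K m) = {}"
    using disjoint unfolding disjoint_complete_graphs_def disjoint_family_on_def by blast
  then show False
    using assms by blast
qed

lemma K_unique': "e \<in> K n \<Longrightarrow> e \<in> K m \<Longrightarrow> n = m"
  using K_unique K_edge by (metis insertI1)

text \<open>The edges at a fixed vertex \<open>a\<close> share \<open>a\<close>, so they lie in one
  component; any other edge \<open>{c, d}\<close> shares \<open>c\<close> with
  \<open>{a, c}\<close>. A vertex set without pairs fits any component.\<close>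

lemma clique_in_component:
  assumes "nsets W 2 \<subseteq> E"
  shows "\<exists>n. nsets W 2 \<subseteq> K n"
proof (cases "nsets W 2 = {}")
  case False
  then obtain a b where ab: "a \<in> W" "b \<in> W" "a \<noteq> b"
    by (auto simp: nsets_2_eq)
  have edge: "{x, y} \<in> E" if "x \<in> W" "y \<in> W" "x \<noteq> y" for x y
    using assms that by (auto simp only: nsets_2_subset_iff)
  obtain n where n: "{a, b} \<in> K n"
    using edge[OF ab] by blast
  have star: "{a, c} \<in> K n" if c: "c \<in> W" "c \<noteq> a" for c
  proof -
    obtain m where "{a, c} \<in> K m"
      using edge[of a c] ab c by blast
    then show ?thesis
      using K_unique[OF n, of "{a, c}" m a] by auto
  qed
  have "{c, d} \<in> K n" if cd: "c \<in> W" "d \<in> W" "c \<noteq> d" for c d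
  proof (cases "c = a")
    case True
    then show ?thesis
      using star cd by auto
  next
    case False
    obtain m where "{c, d} \<in> K m"
      using edge[OF cd] by blast
    then show ?thesis
      using K_unique[OF star[OF cd(1) False], of "{c, d}" m c] by auto
  qed
  then show ?thesis
    by (auto simp: nsets_2_subset_iff)
qed auto

section \<open>Ideal axioms and tallness\<close>

lemma has_clique_E: "has_clique E n"
proof -
  obtain W where "finite W" "card W = n" "K n = nsets W 2"
    using vertex_set by blast
  then show ?thesis
    unfolding has_clique_def by blast
qed

lemma finite_in_clique_ideal: "F \<subseteq> E \<Longrightarrow> finite F \<Longrightarrow> F \<in> clique_ideal E"
  using finite_not_has_clique by (auto simp: clique_ideal_iff)

lemma ideal_on_clique_ideal: "ideal_on E (clique_ideal E)"
  unfolding ideal_on_def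
proof (intro conjI)
  show "clique_ideal E \<subseteq> Pow E"
    unfolding clique_ideal_iff subset_iff by blast
  show "E \<notin> clique_ideal E"
    using has_clique_E by (simp add: clique_ideal_iff)
  show "\<forall>F. F \<subseteq> E \<and> finite F \<longrightarrow> F \<in> clique_ideal E"
    using finite_in_clique_ideal by blast
  show "\<forall>A\<in>clique_ideal E. \<forall>B. B \<subseteq> A \<longrightarrow> B \<in> clique_ideal E"
    using clique_ideal_subset by blast
  show "\<forall>A\<in>clique_ideal E. \<forall>B\<in>clique_ideal E. A \<union> B \<in> clique_ideal E"
    using clique_ideal_Un by blast
qed

text \<open>Since a clique stays within one component, a clique bound uniform over all components is
  a global one.\<close>

lemma clique_ideal_componentwiseI:
  assumes "A \<subseteq> E" "\<And>n. \<not> has_clique (A \<inter> K n) r"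
  shows "A \<in> clique_ideal E"
proof -
  have "\<not> has_clique A r"
  proof
    assume "has_clique A r"
    then obtain W where W: "finite W" "card W = r" "nsets W 2 \<subseteq> A"
      unfolding has_clique_def by blast
    then obtain n where "nsets W 2 \<subseteq> K n"
      using clique_in_component[of W] assms(1) by blast
    then have "has_clique (A \<inter> K n) r"
      unfolding has_clique_def using W by blast
    then show False
      using assms(2) by blast
  qed
  then show ?thesis
    unfolding clique_ideal_iff using assms(1) by blast
qed

text \<open>Components are finite, so an infinite \<open>Y\<close> meets infinitely many of them.
  One edge of \<open>Y\<close> from each gives an infinite set with at most one edge per
  component.\<close>

lemma tall_clique_ideal: "tall_ideal E (clique_ideal E)"
  unfolding tall_ideal_def
proof (intro allI impI)
  fix Y assume Y: "Y \<subseteq> E \<and> infinite Y"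
  define I where "I = {n. Y \<inter> K n \<noteq> {}}"
  define e where "e n = (SOME x. x \<in> Y \<inter> K n)" for n
  have e: "e n \<in> Y \<inter> K n" if "n \<in> I" for n
    unfolding e_def using that someI_ex[of "\<lambda>x. x \<in> Y \<inter> K n"] by (auto simp: I_def)
  have "infinite I"
  proof
    assume "finite I"
    then have "finite (\<Union>n\<in>I. K n)"
      by (simp add: finite_K)
    moreover have "Y \<subseteq> (\<Union>n\<in>I. K n)"
      using Y unfolding I_def by blast
    ultimately show False
      using Y finite_subset by blast
  qed
  moreover have "inj_on e I"
    using e K_unique' by (metis IntD2 inj_onI)
  ultimately have "infinite (e ` I)"
    using finite_imageD by blast
  moreover have "Y \<inter> e ` I = e ` I"
    using e by auto
  moreover have "e ` I \<in> clique_ideal E"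
  proof (rule clique_ideal_componentwiseI)
    show "e ` I \<subseteq> E"
      using e by auto
    fix n
    have sub: "e ` I \<inter> K n \<subseteq> {e n}"
      using e K_unique' by blast
    \<comment> \<open>The number \<open>4\<close> is \<open>card {e n} + 3\<close>.\<close>
    show "\<not> has_clique (e ` I \<inter> K n) 4"
      using finite_not_has_clique[of "{e n}"] has_clique_mono[OF _ sub] by auto
  qed
  ultimately show "\<exists>A\<in>clique_ideal E. infinite (Y \<inter> A)"
    by (metis (no_types, lifting))
qed

section \<open>K-uniformity\<close>

text \<open>Map the component \<open>K n\<close> onto an \<open>n\<close>-clique inside \<open>X\<close> via an injection of vertices.
  Cliques in preimages lie in one component, hence are carried to cliques of the same size;
  the chosen cliques in \<open>X\<close> need not be disjoint.\<close>
lemma K_uniform_clique_ideal: "K_uniform E (clique_ideal E)"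
  unfolding K_uniform_def
proof (intro allI impI)
  fix X assume X: "X \<subseteq> E \<and> X \<notin> clique_ideal E"
  obtain W where W: "\<And>n. finite (W n)" "\<And>n. card (W n) = n" "\<And>n. K n = nsets (W n) 2"
    using vertex_set by metis
  have "\<forall>n. has_clique X n"
    using X by (auto simp: clique_ideal_iff)
  then obtain V where V: "\<And>n. finite (V n)" "\<And>n. card (V n) = n" "\<And>n. nsets (V n) 2 \<subseteq> X"
    unfolding has_clique_def by metis
  have "\<exists>g. bij_betw g (W n) (V n)" for n
    using W V finite_same_card_bij by metis
  then obtain g where g: "\<And>n. bij_betw (g n) (W n) (V n)"
    by metis
  define f where "f e = g (THE n. e \<in> K n) ` e" for e
  have f: "f e = g n ` e" if "e \<in> K n" for e n
  proof -
    have "(THE n. e \<in> K n) = n"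
      using that K_unique' by blast
    then show ?thesis
      by (simp add: f_def)
  qed
  have fV: "f e \<in> nsets (V n) 2" if e: "e \<in> K n" for e n
    using f[OF e] e bij_betwE[OF bij_betw_nsets[OF g]] W(3) by metis
  show "katetov_le X (restrict_ideal (clique_ideal E) X) E (clique_ideal E)"
    unfolding katetov_le_def
  proof (intro bexI[of _ f] ballI)
    show "f \<in> E \<rightarrow> X"
      using fV V(3) by blast
    fix B assume "B \<in> restrict_ideal (clique_ideal E) X"
    then obtain A N where A: "B \<subseteq> A" "\<not> has_clique A N"
      by (auto simp: restrict_ideal_def clique_ideal_iff)
    \<comment> \<open>The summand 2 puts every vertex of \<open>U\<close> on an edge, which forces
      \<open>U \<subseteq> W n\<close>; there \<open>g n\<close> is injective and preserves the
      number of vertices.\<close>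
    have "\<not> has_clique (f -` B \<inter> E) (N + 2)"
    proof
      assume "has_clique (f -` B \<inter> E) (N + 2)"
      then obtain U where U: "finite U" "card U = N + 2" "nsets U 2 \<subseteq> f -` B \<inter> E"
        unfolding has_clique_def by blast
      then obtain n where n: "nsets U 2 \<subseteq> K n"
        using clique_in_component by blast
      have "U \<subseteq> W n"
      proof
        fix x assume "x \<in> U"
        then have "card (U - {x}) = N + 1"
          using U by simp
        then obtain y where "y \<in> U" "y \<noteq> x"
          by (metis Diff_iff Suc_eq_plus1 card_eq_SucD insertI1)
        then have "{x, y} \<in> K n"
          using n \<open>x \<in> U\<close> by (auto simp: nsets_2_subset_iff)
        then show "x \<in> W n"
          by (simp add: W(3))
      qed
      then have inj: "inj_on (g n) U"
        using g bij_betw_imp_inj_on inj_on_subset by blast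
      have "{g n x, g n y} \<in> A" if "x \<in> U" "y \<in> U" "g n x \<noteq> g n y" for x y
      proof -
        have "{x, y} \<in> nsets U 2"
          using that by auto
        then have "f {x, y} \<in> B" "f {x, y} = g n ` {x, y}"
          using U(3) n f by blast+
        then show ?thesis
          using A(1) by auto
      qed
      then have "nsets (g n ` U) 2 \<subseteq> A"
        by (auto simp: nsets_2_subset_iff)
      then have "has_clique A (N + 2)"
        unfolding has_clique_def using U inj by (intro exI[of _ "g n ` U"]) (simp add: card_image)
      then show False
        using A(2) has_clique_le by (metis le_add1)
    qed
    then show "f -` B \<inter> E \<in> clique_ideal E"
      by (auto simp: clique_ideal_iff)
  qed
qed

section \<open>Failure of the reduction to \<open>ED_fin\<close>\<close>

lemma not_katetov_le_ED_fin: "\<not> katetov_le E (clique_ideal E) Delta ED_fin"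
proof
  assume "katetov_le E (clique_ideal E) Delta ED_fin"
  then obtain f where f: "f \<in> Delta \<rightarrow> E"
      and red: "\<And>A. A \<in> clique_ideal E \<Longrightarrow> f -` A \<inter> Delta \<in> ED_fin"
    unfolding katetov_le_def by blast
  \<comment> \<open>\<open>col A n\<close> is the \<open>n\<close>-th column of the preimage of
    \<open>A\<close>.\<close>
  define col where "col A n = {x. x \<le> n \<and> f (n, x) \<in> A}" for A n
  have bounded: "\<exists>k. \<forall>n. card (col A n) \<le> k" if "A \<in> clique_ideal E" for A
    using ED_fin_columns_bounded[OF red[OF that]]
    by (auto simp: col_def Delta_def conj_commute cong: conj_cong)
  have fin_col: "finite (col A n)" for A n
    by (simp add: col_def)
  have block: "\<exists>F m' n. F \<subseteq> (\<Union>i\<in>{m<..m'}. K i) \<and> \<not> has_clique F 3 \<and> j \<le> card (col F n)" for m j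
  proof -
    \<comment> \<open>The components up to \<open>m\<close> have finitely many edges, so under the
      assumed reduction they absorb at most \<open>k\<close> points of each column.\<close>
    have "(\<Union>i\<le>m. K i) \<in> clique_ideal E"
      by (rule finite_in_clique_ideal) (use finite_K_le in auto)
    then obtain k where k: "\<And>n. card (col (\<Union>i\<le>m. K i) n) \<le> k"
      using bounded by blast
    \<comment> \<open>Column \<open>n\<close> of \<open>Delta\<close> has \<open>n + 1\<close>
      points. After discarding at most \<open>k\<close>, more than \<open>2 * j\<close> remain, and
      a cut keeps half of them.\<close>
    define n where "n = k + 2 * j"
    define D where "D = {..n} - col (\<Union>i\<le>m. K i) n"
    have fin_D: "finite D"
      by (simp add: D_def)
    have card_D: "2 * j \<le> card D"
      using k[of n] diff_card_le_card_Diff[OF fin_col[of "\<Union>i\<le>m. K i" n], of "{..n}"]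
      by (simp add: D_def n_def)
    have fD: "f (n, x) \<in> E \<and> f (n, x) \<notin> (\<Union>i\<le>m. K i)" if "x \<in> D" for x
      using that f by (auto simp: D_def col_def Delta_def)
    define V where "V = \<Union>((\<lambda>x. f (n, x)) ` D)"
    have edge: "\<exists>a b. a \<noteq> b \<and> f (n, x) = {a, b}" if "x \<in> D" for x
      using fD[OF that] K_edge by blast
    have "finite V"
      unfolding V_def using fin_D edge by fastforce
    moreover have "\<forall>x\<in>D. f (n, x) \<in> nsets V 2"
    proof
      fix x assume x: "x \<in> D"
      then obtain a b where "a \<noteq> b" "f (n, x) = {a, b}"
        using edge by blast
      moreover from this have "a \<in> V" "b \<in> V"
        using x by (auto simp: V_def)
      ultimately show "f (n, x) \<in> nsets V 2"
        by simp
    qed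
    \<comment> \<open>The count is over points of the column, not over distinct edges, because
      \<open>f\<close> may identify points.\<close>
    ultimately obtain S where S: "card D \<le> 2 * card {x \<in> D. card (f (n, x) \<inter> S) = 1}"
      using half_cut[of V D "\<lambda>x. f (n, x)"] fin_D by blast
    define D' where "D' = {x \<in> D. card (f (n, x) \<inter> S) = 1}"
    define F where "F = (\<lambda>x. f (n, x)) ` D'"
    have "\<not> has_clique F 3"
      by (rule cut_triangle_free[of _ S]) (auto simp: F_def D'_def)
    moreover have "j \<le> card (col F n)"
    proof -
      have "card D' \<le> card (col F n)"
        by (rule card_mono[OF fin_col]) (auto simp: col_def F_def D'_def D_def)
      then show ?thesis
        using S card_D by (simp add: D'_def)
    qed
    moreover have "\<exists>m'. F \<subseteq> (\<Union>i\<in>{m<..m'}. K i)"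
    proof -
      have "\<forall>e\<in>F. \<exists>i. e \<in> K i \<and> m < i"
        using fD by (fastforce simp: F_def D'_def)
      then obtain c where c: "\<And>e. e \<in> F \<Longrightarrow> e \<in> K (c e) \<and> m < c e"
        by metis
      have "finite F"
        by (simp add: F_def D'_def fin_D)
      then have "c e \<le> Max (c ` F)" if "e \<in> F" for e
        using that by simp
      then have "F \<subseteq> (\<Union>i\<in>{m<..Max (c ` F)}. K i)"
        using c by fastforce
      then show ?thesis
        by blast
    qed
    ultimately show ?thesis
      by blast
  qed
  \<comment> \<open>A state pairs the edge set of the latest stage with the last component index
    reserved so far; the next stage uses the interval of indices just after it.\<close>
  define P where "P j p q \<longleftrightarrow> fst q \<subseteq> (\<Union>i\<in>{snd p<..snd q}. K i) \<and> \<not> has_clique (fst q) 3 \<and>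
      snd p \<le> snd q \<and> (\<exists>n. j \<le> card (col (fst q) n))"
    for j :: nat and p q :: "nat set set \<times> nat"
  have "\<exists>q. P j p q" for j p
  proof -
    obtain F m' n where F: "F \<subseteq> (\<Union>i\<in>{snd p<..m'}. K i)" "\<not> has_clique F 3" "j \<le> card (col F n)"
      using block[of "snd p" j] by blast
    \<comment> \<open>The maximum keeps the indices nondecreasing even when \<open>m'\<close> is
      below \<open>snd p\<close>.\<close>
    have "F \<subseteq> (\<Union>i\<in>{snd p<..max m' (snd p)}. K i)"
      using F(1) by fastforce
    then have "P j p (F, max m' (snd p))"
      using F by (auto simp: P_def)
    then show ?thesis
      by blast
  qed
  then obtain s where s: "\<And>j. P j (s j) (s (Suc j))"
    using dependent_nat_choice[of "\<lambda>_ _. True" P] by metis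
  have mono: "snd (s i) \<le> snd (s j)" if "i \<le> j" for i j
  proof -
    have "snd (s i) \<le> snd (s (Suc i))" for i
      using s[of i] unfolding P_def by blast
    then show ?thesis
      using that by (rule lift_Suc_mono_le)
  qed
  \<comment> \<open>The union starts at \<open>s 1\<close>, since the edge set of the initial state
    \<open>s 0\<close> is unconstrained.\<close>
  define A where "A = (\<Union>j. fst (s (Suc j)))"
  have A: "A \<in> clique_ideal E"
  proof (rule clique_ideal_componentwiseI)
    show "A \<subseteq> E"
      using s by (fastforce simp: A_def P_def)
    fix n
    show "\<not> has_clique (A \<inter> K n) 3"
    proof
      assume hc: "has_clique (A \<inter> K n) 3"
      \<comment> \<open>The index intervals of different stages are disjoint, so \<open>K n\<close>
        meets only one stage, and that stage is triangle-free.\<close>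
      have range_n: "snd (s j) < n \<and> n \<le> snd (s (Suc j))"
        if e: "e \<in> fst (s (Suc j))" "e \<in> K n" for e j
      proof -
        obtain i where "i \<in> {snd (s j)<..snd (s (Suc j))}" "e \<in> K i"
          using s[of j] e unfolding P_def by blast
        moreover from this have "i = n"
          using K_unique' e(2) by blast
        ultimately show ?thesis
          by simp
      qed
      have "A \<inter> K n \<noteq> {}"
        using hc by (auto simp: has_clique_def card_3_iff nsets_2_subset_iff)
      then obtain e j where e: "e \<in> fst (s (Suc j))" "e \<in> K n"
        by (auto simp: A_def)
      have "A \<inter> K n \<subseteq> fst (s (Suc j))"
      proof
        fix e' assume "e' \<in> A \<inter> K n"
        then obtain j' where e': "e' \<in> fst (s (Suc j'))" "e' \<in> K n"
          by (auto simp: A_def)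
        have "j' = j"
          using range_n[OF e] range_n[OF e'] mono[of "Suc j" j'] mono[of "Suc j'" j]
          by (cases j j' rule: linorder_cases) auto
        then show "e' \<in> fst (s (Suc j))"
          using e' by simp
      qed
      then show False
        using hc has_clique_mono s[of j] unfolding P_def by blast
    qed
  qed
  obtain k where k: "\<And>n. card (col A n) \<le> k"
    using bounded[OF A] by blast
  \<comment> \<open>Stage \<open>Suc k\<close> produces the state \<open>s (Suc (Suc k))\<close> and
    fills some column with more than \<open>k\<close> points.\<close>
  obtain n where n: "Suc k \<le> card (col (fst (s (Suc (Suc k)))) n)"
    using s[of "Suc k"] by (auto simp: P_def)
  also have "\<dots> \<le> card (col A n)"
    by (rule card_mono[OF fin_col]) (auto simp: col_def A_def)
  finally show False
    using k[of n] by simp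
qed

end

theorem theorem4p1:
  fixes K :: "nat \<Rightarrow> nat set set"
  assumes "disjoint_complete_graphs K"
  defines "E \<equiv> \<Union>n. K n"
  shows "ideal_on E (clique_ideal E) \<and>
         F_sigma_ideal E (clique_ideal E) \<and>
         tall_ideal E (clique_ideal E) \<and>
         K_uniform E (clique_ideal E) \<and>
         \<not> katetov_equivalent E (clique_ideal E) Delta ED_fin"
proof -
  interpret clique_sequence K
    by unfold_locales (rule assms(1))
  show ?thesis
    unfolding E_def katetov_equivalent_def
    by (intro conjI ideal_on_clique_ideal F_sigma_clique_ideal tall_clique_ideal
        K_uniform_clique_ideal)
      (simp add: not_katetov_le_ED_fin)
qed

end
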